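(* Let $m>1$ and $n\ge 1$ be integers. For $i\in\{1,\dots,m\}$ let $A_i\in\mathbb{R}^{n_i\times n}$ and $b_i\in\mathbb{R}^{n_i}$, let $A$ be the matrix obtained by stacking $A_1,\dots,A_m$ and $b$ the vector obtained by stacking $b_1,\dots,b_m$, and suppose that $Ax=b$ has at least one solution. Let $P_i$ be the orthogonal projection matrix onto $\ker A_i$. Let $\mathbb{N}(t)$, $t=1,2,\dots$, be a sequence of neighbor graphs with neighbor sets $\mathcal{N}_i(t)$, and let $m_i(t)$ be the number of elements of $\mathcal{N}_i(t)$. Suppose each agent $i$ has a state $x_i(t)\in\mathbb{R}^n$ whose initial value $x_i(1)$ satisfies $A_ix_i(1)=b_i$ and which is updated by $$x_i(t+1)=x_i(t)-\frac{1}{m_i(t)}P_i\Bigl(m_i(t)x_i(t)-\sum_{j\in\mathcal{N}_i(t)}x_j(t)\Bigr),\qquad t\ge 1 .$$ If the sequence of neighbor graphs $\mathbb{N}(t)$, $t\ge1$, is repeatedly jointly strongly connected, then there exists a positive constant $\lambda<1$ for which all $x_i(t)$, $i\in\{1,\dots,m\}$, converge to the same solution to $Ax=b$ as $t\to\infty$, as fast as $\lambda^t$ converges to $0$.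
   Context: Neighbor graphs: there are $m$ agents labelled $1,\dots,m$. At each time $t$ agent $i$ has a set of neighbors $\mathcal{N}_i(t)\subset\{1,\dots,m\}$ with $i\in\mathcal{N}_i(t)$ always. $\mathbb{N}(t)$ is the directed graph on $\{1,\dots,m\}$ with an arc from $j$ to $i$ exactly when $j\in\mathcal{N}_i(t)$. $\mathcal{G}_{sa}$ is the set of directed graphs on $\{1,\dots,m\}$ with self-arcs at all vertices. For $\mathbb{G}_p,\mathbb{G}_q\in\mathcal{G}_{sa}$ the composition $\mathbb{G}_q\circ\mathbb{G}_p\in\mathcal{G}_{sa}$ has $(i,j)$ as an arc exactly when there is a vertex $k$ such that $(i,k)$ is an arc in $\mathbb{G}_p$ and $(k,j)$ is an arc in $\mathbb{G}_q$; composition is associative. An infinite sequence $\mathbb{G}_1,\mathbb{G}_2,\dots$ in $\mathcal{G}_{sa}$ is repeatedly jointly strongly connected if for some positive integers $l$ and $\tau_0$ and each integer $k>0$ the composed graph $\mathbb{G}_{kl+\tau_0-1}\circ\mathbb{G}_{kl+\tau_0-2}\circ\cdots\circ\mathbb{G}_{(k-1)l+\tau_0}$ is strongly connected. "$x_i(t)$ converges to $x^\infty$ as fast as $\lambda^t$ converges to $0$" means that there is a constant $c$ with $|x_i(t)-x^\infty|_2\le c\lambda^t$ for all $t\ge1$. *)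

theory Defs
  imports
    "HOL-Analysis.L2_Norm"
    "Jordan_Normal_Form.Matrix"
    "Jordan_Normal_Form.Matrix_Kernel"
    "Graph_Theory.Pair_Digraph"
    "Graph_Theory.Digraph_Component"
begin

definition neighbor_graph :: "nat \<Rightarrow> (nat \<Rightarrow> nat set) \<Rightarrow> nat pair_pre_digraph" where
  "neighbor_graph m Ns = \<lparr> pverts = {1..m}, parcs = {(j, i). i \<in> {1..m} \<and> j \<in> Ns i} \<rparr>"

text \<open>In \<open>comp_digraph Gq Gp\<close> the graph \<open>Gp\<close> is traversed first;
  the operands of \<open>O\<close> are therefore in the opposite order.\<close>

definition comp_digraph :: "'a pair_pre_digraph \<Rightarrow> 'a pair_pre_digraph \<Rightarrow> 'a pair_pre_digraph"
  where "comp_digraph Gq Gp = \<lparr> pverts = pverts Gp \<union> pverts Gq, parcs = parcs Gp O parcs Gq \<rparr>"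

text \<open>For \<open>s \<le> e\<close>, \<open>comp_interval G s e\<close> is the composition of \<open>G e, G (e - 1), \<dots>, G s\<close>,
  with \<open>G s\<close> traversed first.\<close>

definition comp_interval :: "(nat \<Rightarrow> 'a pair_pre_digraph) \<Rightarrow> nat \<Rightarrow> nat \<Rightarrow> 'a pair_pre_digraph" where
  "comp_interval G s e = fold (\<lambda>t H. comp_digraph (G t) H) [Suc s..<Suc e] (G s)"

definition repeatedly_jointly_strongly_connected :: "(nat \<Rightarrow> 'a pair_pre_digraph) \<Rightarrow> bool" where
  "repeatedly_jointly_strongly_connected G \<longleftrightarrow>
     (\<exists>l>0. \<exists>\<tau>\<^sub>0>0. \<forall>k>0.
        strongly_connected (with_proj (comp_interval G ((k - 1) * l + \<tau>\<^sub>0) (k * l + \<tau>\<^sub>0 - 1))))"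

definition stack_mat :: "nat \<Rightarrow> nat \<Rightarrow> (nat \<Rightarrow> 'a mat) \<Rightarrow> 'a mat" where
  "stack_mat n m A = mat_of_rows n (concat (map (\<lambda>i. rows (A i)) [1..<Suc m]))"

definition stack_vec :: "nat \<Rightarrow> (nat \<Rightarrow> 'a vec) \<Rightarrow> 'a vec" where
  "stack_vec m b = vec_of_list (concat (map (\<lambda>i. list_of_vec (b i)) [1..<Suc m]))"

definition is_orthogonal_projection :: "nat \<Rightarrow> real vec set \<Rightarrow> real mat \<Rightarrow> bool" where
  "is_orthogonal_projection n W P \<longleftrightarrow>
     P \<in> carrier_mat n n \<and>
     (\<forall>v\<in>carrier_vec n. P *\<^sub>v v \<in> W \<and> (\<forall>w\<in>W. (v - P *\<^sub>v v) \<bullet> w = 0))"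

definition vec_norm2 :: "real vec \<Rightarrow> real" where
  "vec_norm2 v = L2_set (($) v) {..<dim_vec v}"

definition converges_as_fast_as :: "(nat \<Rightarrow> real vec) \<Rightarrow> real vec \<Rightarrow> real \<Rightarrow> bool" where
  "converges_as_fast_as y z \<rho> \<longleftrightarrow> (\<exists>c. \<forall>t\<ge>1. vec_norm2 (y t - z) \<le> c * \<rho> ^ t)"

end

theory Submission
  imports
    Defs
    "HOL-Analysis.Inner_Product"
    "HOL-Analysis.Elementary_Metric_Spaces"
    "HOL-Analysis.Function_Topology"
    "HOL-Library.Poly_Mapping"
begin

text \<open>
  For a solution \<open>z\<close> of \<open>A x = b\<close> the errors \<open>e\<^sub>i = x\<^sub>i - z\<close> stay in \<open>ker A\<^sub>i\<close> and obey
  \<open>e\<^sub>i(t + 1) = P\<^sub>i (average of e\<^sub>j(t) over the neighbors j)\<close>. Each step is nonexpansive in the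
  norm \<open>max\<^sub>i |e\<^sub>i|\<close> and fixes every configuration \<open>(u, \<dots>, u)\<close> with \<open>u\<close> in
  \<open>K = \<Inter>\<^sub>i ker A\<^sub>i\<close>. By strict convexity, an agent can keep the maximal norm only if all its
  neighbors had the same error vector; after \<open>m\<close> jointly strongly connected periods this reaches
  all agents, so the common vector lies in \<open>K\<close>. Hence such a block strictly decreases the distance to
  \<open>{(u, \<dots>, u) | u \<in> K}\<close>, and, since only finitely many blocks exist, compactness yields a
  uniform factor below 1.
\<close>

section \<open>Finitely supported functions as an inner product space\<close>

text \<open>The dimension of the system is a variable of the statement and not a type. All its vectors are
  therefore embedded into \<open>nat \<Rightarrow>\<^sub>0 real\<close>.\<close>

instantiation poly_mapping :: (type, real_inner) real_inner
begin

definition scaleR_poly_mapping :: "real \<Rightarrow> ('a \<Rightarrow>\<^sub>0 'b) \<Rightarrow> 'a \<Rightarrow>\<^sub>0 'b" where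
  "scaleR_poly_mapping r p = Poly_Mapping.map ((*\<^sub>R) r) p"

definition inner_poly_mapping :: "('a \<Rightarrow>\<^sub>0 'b) \<Rightarrow> ('a \<Rightarrow>\<^sub>0 'b) \<Rightarrow> real" where
  "inner_poly_mapping p q = (\<Sum>k\<in>Poly_Mapping.keys p. inner (Poly_Mapping.lookup p k) (Poly_Mapping.lookup q k))"

definition norm_poly_mapping :: "('a \<Rightarrow>\<^sub>0 'b) \<Rightarrow> real" where
  "norm_poly_mapping p = sqrt (inner p p)"

definition sgn_poly_mapping :: "('a \<Rightarrow>\<^sub>0 'b) \<Rightarrow> 'a \<Rightarrow>\<^sub>0 'b" where
  "sgn_poly_mapping p = inverse (norm p) *\<^sub>R p"

definition dist_poly_mapping :: "('a \<Rightarrow>\<^sub>0 'b) \<Rightarrow> ('a \<Rightarrow>\<^sub>0 'b) \<Rightarrow> real" where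
  "dist_poly_mapping p q = norm (p - q)"

definition uniformity_poly_mapping :: "(('a \<Rightarrow>\<^sub>0 'b) \<times> ('a \<Rightarrow>\<^sub>0 'b)) filter" where
  "uniformity_poly_mapping = (INF e\<in>{0<..}. principal {(p, q). dist p q < e})"

definition open_poly_mapping :: "('a \<Rightarrow>\<^sub>0 'b) set \<Rightarrow> bool" where
  "open_poly_mapping U \<longleftrightarrow> (\<forall>p\<in>U. \<forall>\<^sub>F (p', q) in uniformity. p' = p \<longrightarrow> q \<in> U)"

lemma lookup_scaleR [simp]: "Poly_Mapping.lookup (r *\<^sub>R p) k = r *\<^sub>R Poly_Mapping.lookup p k"
  by (simp add: scaleR_poly_mapping_def map.rep_eq when_def)

text \<open>The definition sums over the keys of the left argument only. Terms outside the common
  support vanish, so the index set can be chosen freely, for instance as the keys of the right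
  argument.\<close>

lemma inner_poly_mapping_eq_sum:
  assumes "finite S" and "\<And>k. Poly_Mapping.lookup p k \<noteq> 0 \<Longrightarrow> Poly_Mapping.lookup q k \<noteq> 0 \<Longrightarrow> k \<in> S"
  shows "inner p q = (\<Sum>k\<in>S. inner (Poly_Mapping.lookup p k) (Poly_Mapping.lookup q k))"
proof -
  have "inner (Poly_Mapping.lookup p k) (Poly_Mapping.lookup q k) = 0" if "k \<notin> S" for k
    using assms(2) [of k] that by (metis inner_zero_left inner_zero_right)
  then show ?thesis
    unfolding inner_poly_mapping_def
    by (intro sum.mono_neutral_cong) (use assms(1) in \<open>auto simp: in_keys_iff\<close>)
qed

instance
proof
  fix p q s :: "'a \<Rightarrow>\<^sub>0 'b" and r r' :: real
  show "r *\<^sub>R (p + q) = r *\<^sub>R p + r *\<^sub>R q" "(r + r') *\<^sub>R p = r *\<^sub>R p + r' *\<^sub>R p"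
    "r *\<^sub>R r' *\<^sub>R p = (r * r') *\<^sub>R p" "1 *\<^sub>R p = p"
    by (auto intro!: poly_mapping_eqI simp: lookup_add scaleR_add_right scaleR_add_left)
  have "inner q p = (\<Sum>k\<in>Poly_Mapping.keys p. inner (Poly_Mapping.lookup q k) (Poly_Mapping.lookup p k))"
    by (rule inner_poly_mapping_eq_sum) (auto simp: in_keys_iff)
  then show "inner p q = inner q p"
    by (simp add: inner_poly_mapping_def inner_commute)
  \<comment> \<open>Indexing by the keys of the fixed argument \<open>s\<close> gives
    \<open>p\<close>, \<open>q\<close> and \<open>p + q\<close> the same index set, so linearity in
    the first argument is termwise.\<close>
  have on_keys: "inner t s = (\<Sum>k\<in>Poly_Mapping.keys s. inner (Poly_Mapping.lookup t k) (Poly_Mapping.lookup s k))" for t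
    by (rule inner_poly_mapping_eq_sum) (auto simp: in_keys_iff)
  show "inner (p + q) s = inner p s + inner q s"
    by (simp add: on_keys lookup_add inner_add_left sum.distrib)
  show "inner (r *\<^sub>R p) s = r * inner p s"
    by (simp add: on_keys sum_distrib_left)
  show "0 \<le> inner p p"
    by (simp add: inner_poly_mapping_def sum_nonneg)
  show "inner p p = 0 \<longleftrightarrow> p = 0"
  proof
    assume "inner p p = 0"
    then have "\<forall>k\<in>Poly_Mapping.keys p. inner (Poly_Mapping.lookup p k) (Poly_Mapping.lookup p k) = 0"
      unfolding inner_poly_mapping_def by (subst (asm) sum_nonneg_eq_0_iff) auto
    then show "p = 0"
      by (intro poly_mapping_eqI) (auto simp: in_keys_iff)
  qed (simp add: inner_poly_mapping_def)
qed (simp_all add: norm_poly_mapping_def sgn_poly_mapping_def dist_poly_mapping_def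
    uniformity_poly_mapping_def open_poly_mapping_def)

end

section \<open>Compactness of closed bounded sets with uniformly finite support\<close>

lemma compact_PiE:
  fixes F :: "'i \<Rightarrow> 'a::topological_space set"
  assumes "\<And>i. i \<in> I \<Longrightarrow> compact (F i)"
  shows "compact (PiE I F)"
proof -
  \<comment> \<open>Extensional functions are \<open>undefined\<close> outside \<open>I\<close>,
    which amounts to compact singleton factors there; Tychonoff's theorem then applies over the
    whole index type.\<close>
  have eq: "PiE I F = PiE UNIV (\<lambda>i. if i \<in> I then F i else {undefined})"
    by (auto simp: PiE_iff extensional_def split: if_splits)
  have "compactin (product_topology (\<lambda>_. euclidean) UNIV)
      (PiE UNIV (\<lambda>i. if i \<in> I then F i else {undefined}))"
    by (subst compactin_PiE) (use assms in auto)
  then show ?thesis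
    by (simp add: eq euclidean_product_topology)
qed

lemma norm_lookup_le_norm: "norm (Poly_Mapping.lookup p k) \<le> norm p"
proof -
  have "(norm (Poly_Mapping.lookup p k))\<^sup>2 \<le> (\<Sum>k\<in>insert k (Poly_Mapping.keys p). (norm (Poly_Mapping.lookup p k))\<^sup>2)"
    by (rule member_le_sum) auto
  also have "\<dots> = inner p p"
    by (subst inner_poly_mapping_eq_sum [of "insert k (Poly_Mapping.keys p)"]) (auto simp: in_keys_iff power2_norm_eq_inner)
  also have "\<dots> = (norm p)\<^sup>2"
    by (simp add: power2_norm_eq_inner)
  finally show ?thesis
    by (simp add: power2_le_iff_abs_le)
qed

text \<open>Elements of \<open>C\<close> are determined by their coordinates in \<open>S\<close>,
  all of which lie in [-r, r]. So \<open>C\<close> is a closed subset of a continuous image of a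
  compact box.\<close>

lemma compact_finitely_supported:
  fixes C :: "('k \<Rightarrow>\<^sub>0 real) set"
  assumes closed: "closed C" and norm: "\<And>p. p \<in> C \<Longrightarrow> norm p \<le> r"
    and S: "finite S" "\<And>p. p \<in> C \<Longrightarrow> Poly_Mapping.keys p \<subseteq> S"
  shows "compact C"
proof -
  define f :: "('k \<Rightarrow> real) \<Rightarrow> 'k \<Rightarrow>\<^sub>0 real"
    where "f c = (\<Sum>k\<in>S. c k *\<^sub>R Poly_Mapping.single k 1)" for c
  let ?B = "PiE S (\<lambda>_. {-r..r})"
  have lookup_f: "Poly_Mapping.lookup (f c) k = (if k \<in> S then c k else 0)" for c k
  proof -
    have "Poly_Mapping.lookup (f c) k = (\<Sum>i\<in>S. if i = k then c i else 0)"
      unfolding f_def lookup_sum by (rule sum.cong) (auto simp: lookup_single)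
    then show ?thesis by (simp add: S)
  qed
  have "continuous_on UNIV f"
    unfolding f_def
    by (intro continuous_on_sum continuous_on_scaleR continuous_on_product_coordinates continuous_on_const)
  then have "compact (f ` ?B)"
    by (meson compact_continuous_image compact_PiE compact_Icc continuous_on_subset subset_UNIV)
  moreover have "C \<subseteq> f ` ?B"
  proof
    fix p assume p: "p \<in> C"
    have "p = f (restrict (Poly_Mapping.lookup p) S)"
      by (rule poly_mapping_eqI) (use S(2) [OF p] in \<open>auto simp: lookup_f subset_iff in_keys_iff\<close>)
    moreover have "restrict (Poly_Mapping.lookup p) S \<in> ?B"
    proof (intro restrict_PiE_iff [THEN iffD2] ballI)
      fix k
      have "\<bar>Poly_Mapping.lookup p k\<bar> \<le> r"
        using norm_lookup_le_norm [of p k] norm [OF p] by simp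
      then show "Poly_Mapping.lookup p k \<in> {-r..r}"
        by (auto simp: abs_le_iff)
    qed
    ultimately show "p \<in> f ` ?B" by blast
  qed
  ultimately show ?thesis
    using compact_Int_closed [OF _ closed, of "f ` ?B"] by (simp add: Int_absorb1)
qed

section \<open>Orthogonal projections and averages\<close>

definition orthogonal_projection_onto :: "'a::real_inner set \<Rightarrow> ('a \<Rightarrow> 'a) \<Rightarrow> bool" where
  "orthogonal_projection_onto W p \<longleftrightarrow>
     Real_Vector_Spaces.subspace W \<and> linear p \<and> (\<forall>v. p v \<in> W) \<and> (\<forall>v. \<forall>w\<in>W. inner (v - p v) w = 0)"

context
  fixes W :: "'a::real_inner set" and p
  assumes p: "orthogonal_projection_onto W p"
begin

lemma orthogonal_projection_pythagoras: "(norm v)\<^sup>2 = (norm (p v))\<^sup>2 + (norm (v - p v))\<^sup>2"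
proof -
  have "inner (v - p v) (p v) = 0"
    using p by (simp add: orthogonal_projection_onto_def)
  then show ?thesis
    by (simp add: power2_norm_eq_inner inner_diff_left inner_diff_right inner_commute)
qed

lemma norm_orthogonal_projection_le: "norm (p v) \<le> norm v"
  using orthogonal_projection_pythagoras [of v] by (simp add: power2_le_imp_le)

lemma norm_orthogonal_projection_residual_le: "norm (v - p v) \<le> norm v"
  using orthogonal_projection_pythagoras [of v] by (simp add: power2_le_imp_le)

text \<open>Equal norms make the residual vanish in the Pythagorean identity. This is the projection
  half of the rigidity argument; averaging is the other half.\<close>

lemma orthogonal_projection_eqI: "norm (p v) = norm v \<Longrightarrow> p v = v"
  using orthogonal_projection_pythagoras [of v] by simp

lemma orthogonal_projection_id:
  assumes "w \<in> W"
  shows "p w = w"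
proof -
  have "w - p w \<in> W"
    using p assms by (simp add: orthogonal_projection_onto_def subspace_diff)
  then have "inner (w - p w) (w - p w) = 0"
    using p by (simp add: orthogonal_projection_onto_def)
  then show ?thesis by simp
qed

lemma bounded_linear_orthogonal_projection: "bounded_linear p"
proof (intro bounded_linear.intro bounded_linear_axioms.intro exI [of _ 1] allI)
  show "linear p"
    using p by (simp add: orthogonal_projection_onto_def)
qed (simp add: norm_orthogonal_projection_le)

text \<open>\<open>W\<close> is the fixed point set of the continuous map \<open>p\<close>, so no
  dimension argument is involved.\<close>

lemma closed_orthogonal_projection_onto: "closed W"
proof -
  have "p v \<in> W" for v
    using p by (simp add: orthogonal_projection_onto_def)
  then have "W = {v. p v = v}"
    using orthogonal_projection_id by (metis (mono_tags, lifting) Collect_cong Collect_mem_eq)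
  moreover have "closed {v. p v = v}"
    by (intro closed_Collect_eq continuous_on_id
        bounded_linear.continuous_on [OF bounded_linear_orthogonal_projection])
  ultimately show ?thesis by simp
qed

end

section \<open>Averages, strict convexity and finite families of bounds\<close>

lemma norm_average_le:
  assumes "finite S" "S \<noteq> {}" "\<And>j. j \<in> S \<Longrightarrow> norm (f j) \<le> M"
  shows "norm ((1 / real (card S)) *\<^sub>R (\<Sum>j\<in>S. f j)) \<le> M"
proof -
  have "norm (\<Sum>j\<in>S. f j) \<le> real (card S) * M"
    by (rule sum_norm_bound) (rule assms)
  then show ?thesis
    using assms by (simp add: field_simps card_gt_0_iff)
qed

text \<open>Strict convexity in quantitative form: if the average \<open>w\<close> has norm
  \<open>M\<close>, the squared distances of the \<open>f j\<close> from \<open>w\<close> sum to at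
  most 2 \<open>card S\<close> (M^2 - <w, w>) = 0.\<close>

lemma eq_average_if_norm_maximal:
  fixes f :: "'i \<Rightarrow> 'a::real_inner"
  assumes S: "finite S" "S \<noteq> {}" and le: "\<And>j. j \<in> S \<Longrightarrow> norm (f j) \<le> M"
    and max: "norm ((1 / real (card S)) *\<^sub>R (\<Sum>j\<in>S. f j)) = M" and j: "j \<in> S"
  shows "f j = (1 / real (card S)) *\<^sub>R (\<Sum>j\<in>S. f j)"
proof -
  define w where "w = (1 / real (card S)) *\<^sub>R (\<Sum>j\<in>S. f j)"
  have card: "real (card S) > 0"
    using S by (simp add: card_gt_0_iff)
  have M: "inner w w = M\<^sup>2"
    using max by (simp add: w_def power2_norm_eq_inner flip: power2_norm_eq_inner)
  have sum_f: "(\<Sum>j\<in>S. f j) = real (card S) *\<^sub>R w"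
    using card by (simp add: w_def)
  have "(norm (f j - w))\<^sup>2 \<le> 2 * M\<^sup>2 - 2 * inner (f j) w" if "j \<in> S" for j
  proof -
    have "(norm (f j - w))\<^sup>2 = (norm (f j))\<^sup>2 + M\<^sup>2 - 2 * inner (f j) w"
      using M by (simp add: power2_norm_eq_inner inner_diff_left inner_diff_right inner_commute)
    moreover have "(norm (f j))\<^sup>2 \<le> M\<^sup>2"
      using le [OF that] by (simp add: power_mono)
    ultimately show ?thesis by simp
  qed
  then have "(\<Sum>j\<in>S. (norm (f j - w))\<^sup>2) \<le> (\<Sum>j\<in>S. 2 * M\<^sup>2 - 2 * inner (f j) w)"
    by (rule sum_mono)
  also have "\<dots> = real (card S) * (2 * M\<^sup>2) - 2 * inner (\<Sum>j\<in>S. f j) w"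
    by (simp add: sum_subtractf inner_sum_left sum_distrib_left)
  also have "\<dots> = 0"
    by (simp add: sum_f M)
  finally have "(\<Sum>j\<in>S. (norm (f j - w))\<^sup>2) = 0"
    by (simp add: antisym sum_nonneg)
  then have "\<forall>j\<in>S. (norm (f j - w))\<^sup>2 = 0"
    by (subst (asm) sum_nonneg_eq_0_iff) (use S in auto)
  then show ?thesis
    using j by (simp add: w_def)
qed

text \<open>The maximum of finitely many bounds below 1 is below 1. The floor 1/2 serves
  \<open>uniform_contraction\<close>, where a configuration may already be within half the radius,
  and keeps \<theta> positive for the root taken in \<open>geometric_convergence\<close>.\<close>

lemma uniform_bound_below_1:
  fixes f :: "'s \<Rightarrow> 'e \<Rightarrow> real"
  assumes "finite S" "\<And>s. s \<in> S \<Longrightarrow> \<exists>\<theta><1. \<forall>e\<in>K. f s e \<le> \<theta>"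
  shows "\<exists>\<theta>\<ge>1 / 2. \<theta> < 1 \<and> (\<forall>s\<in>S. \<forall>e\<in>K. f s e \<le> \<theta>)"
  using assms
proof (induction S rule: finite_induct)
  case empty
  then show ?case by (intro exI [of _ "1 / 2"]) simp
next
  case (insert s S)
  then obtain \<theta> \<theta>' where "1 / 2 \<le> \<theta>" "\<theta> < 1" "\<forall>s\<in>S. \<forall>e\<in>K. f s e \<le> \<theta>"
    and "\<theta>' < 1" "\<forall>e\<in>K. f s e \<le> \<theta>'"
    by (metis insertCI)
  then show ?case
    by (intro exI [of _ "max \<theta> \<theta>'"]) (auto simp: le_max_iff_disj)
qed

section \<open>Contraction of projected averaging\<close>

definition projected_average ::
    "('v \<Rightarrow> 'a \<Rightarrow> 'a) \<Rightarrow> ('v \<Rightarrow> 'v set) \<Rightarrow> ('v \<Rightarrow> 'a::real_vector) \<Rightarrow> 'v \<Rightarrow> 'a" where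
  "projected_average p g e i = p i ((1 / real (card (g i))) *\<^sub>R (\<Sum>j\<in>g i. e j))"

text \<open>\<open>(j, i) \<in> walks V [g\<^sub>1, \<dots>, g\<^sub>k]\<close> if the error of \<open>j\<close> before the \<open>k\<close> steps influences that of
  \<open>i\<close> after them; \<open>g\<^sub>1\<close> is the neighbor map of the first step.\<close>

primrec walks :: "'v set \<Rightarrow> ('v \<Rightarrow> 'v set) list \<Rightarrow> 'v rel" where
  "walks V [] = Id"
| "walks V (g # gs) = {(j, i). i \<in> V \<and> j \<in> g i} O walks V gs"

text \<open>Finite dimension enters only through the compact unit balls of the subspaces
  \<open>W i\<close>; the ambient space may be infinite-dimensional.\<close>

locale projected_averaging =
  fixes V :: "'v set" and W :: "'v \<Rightarrow> 'a::real_inner set" and p :: "'v \<Rightarrow> 'a \<Rightarrow> 'a"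
  assumes finite_V: "finite V" and V_nonempty: "V \<noteq> {}"
    and proj: "\<And>i. i \<in> V \<Longrightarrow> orthogonal_projection_onto (W i) (p i)"
    and compact_W: "\<And>i. i \<in> V \<Longrightarrow> compact (W i \<inter> cball 0 1)"
begin

text \<open>Extensionality makes this set finite, hence also the set of blocks of a given length.
  Nonempty neighbor sets make every average a genuine one.\<close>

definition graphs :: "('v \<Rightarrow> 'v set) set" where
  "graphs = PiE V (\<lambda>_. Pow V - {{}})"

abbreviation run :: "('v \<Rightarrow> 'v set) list \<Rightarrow> ('v \<Rightarrow> 'a) \<Rightarrow> 'v \<Rightarrow> 'a" where
  "run \<equiv> fold (projected_average p)"

definition common :: "'a set" where
  "common = (\<Inter>i\<in>V. W i)"

section \<open>Affine equivariance and nonexpansiveness of runs\<close>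

lemma graphsD:
  assumes "g \<in> graphs" "i \<in> V"
  shows "g i \<subseteq> V" "g i \<noteq> {}" "finite (g i)"
  using assms finite_V by (auto simp: graphs_def PiE_iff intro: finite_subset)

lemma finite_graphs: "finite graphs"
  unfolding graphs_def using finite_V by (intro finite_PiE) auto

text \<open>Every \<open>p i\<close> fixes \<open>u\<close>, and averages preserve constants, so a
  step commutes with subtracting \<open>u\<close> and with scaling. Relating \<open>e'\<close> to
  \<open>e\<close> on \<open>V\<close> only makes \<open>u = 0\<close>, \<open>c = 1\<close> a
  congruence rule and admits configurations restricted to \<open>V\<close>.\<close>

lemma step_affine:
  assumes g: "g \<in> graphs" and u: "u \<in> common" and e': "\<And>j. j \<in> V \<Longrightarrow> e' j = c *\<^sub>R (e j - u)"
    and i: "i \<in> V"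
  shows "projected_average p g e' i = c *\<^sub>R (projected_average p g e i - u)"
proof -
  note g_i = graphsD [OF g i]
  have lin: "linear (p i)" and u': "p i u = u"
    using proj [OF i] u i
    by (auto simp: orthogonal_projection_onto_def common_def intro: orthogonal_projection_id)
  have "(\<Sum>j\<in>g i. e' j) = (\<Sum>j\<in>g i. c *\<^sub>R (e j - u))"
    using g_i e' by (intro sum.cong) auto
  also have "\<dots> = c *\<^sub>R ((\<Sum>j\<in>g i. e j) - real (card (g i)) *\<^sub>R u)"
    by (simp add: sum_subtractf sum_constant_scaleR flip: scaleR_sum_right)
  finally have "(1 / real (card (g i))) *\<^sub>R (\<Sum>j\<in>g i. e' j)
      = c *\<^sub>R ((1 / real (card (g i))) *\<^sub>R (\<Sum>j\<in>g i. e j) - u)"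
    using g_i by (simp add: scaleR_diff_right card_gt_0_iff)
  then show ?thesis
    by (simp add: projected_average_def linear_scale [OF lin] linear_diff [OF lin] u')
qed

lemma run_affine:
  assumes "set gs \<subseteq> graphs" "u \<in> common" "\<And>j. j \<in> V \<Longrightarrow> e' j = c *\<^sub>R (e j - u)" "i \<in> V"
  shows "run gs e' i = c *\<^sub>R (run gs e i - u)"
  using assms
proof (induction gs arbitrary: e e')
  case (Cons g gs)
  have "run gs (projected_average p g e') i = c *\<^sub>R (run gs (projected_average p g e) i - u)"
    using Cons.prems by (intro Cons.IH step_affine) auto
  then show ?case by simp
qed simp

lemma zero_common: "0 \<in> common"
  using proj by (auto simp: common_def orthogonal_projection_onto_def subspace_0)

lemma step_cong:
  assumes "g \<in> graphs" "\<And>j. j \<in> V \<Longrightarrow> e' j = e j" "i \<in> V"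
  shows "projected_average p g e' i = projected_average p g e i"
  using step_affine [OF assms(1) zero_common, of e' 1 e i] assms by simp

lemma norm_step_le:
  assumes g: "g \<in> graphs" and le: "\<And>j. j \<in> V \<Longrightarrow> norm (e j) \<le> M" and i: "i \<in> V"
  shows "norm (projected_average p g e i) \<le> M"
proof -
  have "norm (projected_average p g e i) \<le> norm ((1 / real (card (g i))) *\<^sub>R (\<Sum>j\<in>g i. e j))"
    unfolding projected_average_def by (rule norm_orthogonal_projection_le [OF proj [OF i]])
  also have "\<dots> \<le> M"
    using graphsD [OF g i] le by (intro norm_average_le) auto
  finally show ?thesis .
qed

lemma norm_run_le:
  assumes "set gs \<subseteq> graphs" "\<And>j. j \<in> V \<Longrightarrow> norm (e j) \<le> M" "i \<in> V"
  shows "norm (run gs e i) \<le> M"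
  using assms
proof (induction gs arbitrary: e)
  case (Cons g gs)
  have "norm (run gs (projected_average p g e) i) \<le> M"
    using Cons.prems by (intro Cons.IH norm_step_le) auto
  then show ?case by simp
qed simp

lemma step_in_W: "i \<in> V \<Longrightarrow> projected_average p g e i \<in> W i"
  using proj by (simp add: projected_average_def orthogonal_projection_onto_def)

lemma run_in_W: "(\<And>j. j \<in> V \<Longrightarrow> e j \<in> W j) \<Longrightarrow> i \<in> V \<Longrightarrow> run gs e i \<in> W i"
  by (induction gs arbitrary: e) (simp_all add: step_in_W)

section \<open>Rigidity when the maximal norm is kept\<close>

lemma eq_step_if_norm_maximal:
  assumes g: "g \<in> graphs" and le: "\<And>j. j \<in> V \<Longrightarrow> norm (e j) \<le> M" and i: "i \<in> V"
    and max: "norm (projected_average p g e i) = M" and j: "j \<in> g i"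
  shows "e j = projected_average p g e i"
proof -
  note g_i = graphsD [OF g i]
  define w where "w = (1 / real (card (g i))) *\<^sub>R (\<Sum>j\<in>g i. e j)"
  have w: "norm w \<le> M"
    unfolding w_def using g_i le by (intro norm_average_le) auto
  have pw: "projected_average p g e i = p i w"
    by (simp add: projected_average_def w_def)
  \<comment> \<open>The chain \<open>norm (p i w)\<close> \<le> \<open>norm w\<close> \<le>
    \<open>M\<close> has equal ends. Tightness of the first inequality gives
    \<open>p i w = w\<close>; tightness of the second makes every neighbor's vector equal to
    \<open>w\<close>.\<close>
  have "norm w = M"
    using w max norm_orthogonal_projection_le [OF proj [OF i], of w] by (simp add: pw)
  moreover from this have "p i w = w"
    using max pw by (intro orthogonal_projection_eqI [OF proj [OF i]]) simp
  moreover have "e j = w"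
    unfolding w_def
    using g_i le j \<open>norm w = M\<close> by (intro eq_average_if_norm_maximal [where M = M]) (auto simp: w_def)
  ultimately show ?thesis by (simp add: pw)
qed

text \<open>A maximal vector propagates backwards along a walk: the induction hypothesis transports
  it to the vertex \<open>k\<close> after the first step, where it still has norm \<open>M\<close>,
  so one-step rigidity carries it on to \<open>j\<close>.\<close>

lemma eq_run_if_norm_maximal:
  assumes "set gs \<subseteq> graphs" "\<And>j. j \<in> V \<Longrightarrow> norm (e j) \<le> M" "i \<in> V"
    and "norm (run gs e i) = M" "(j, i) \<in> walks V gs"
  shows "e j = run gs e i"
  using assms
proof (induction gs arbitrary: e j)
  case (Cons g gs)
  let ?e = "projected_average p g e"
  obtain k where k: "k \<in> V" "j \<in> g k" "(k, i) \<in> walks V gs"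
    using Cons.prems by auto
  have "?e k = run gs ?e i"
    using Cons.prems k by (intro Cons.IH norm_step_le) auto
  moreover have "e j = ?e k"
    using Cons.prems k calculation by (intro eq_step_if_norm_maximal) auto
  ultimately show ?case by simp
qed simp

section \<open>Uniform contraction by compactness\<close>

lemma continuous_on_run:
  assumes "set gs \<subseteq> graphs" "i \<in> V"
  shows "continuous_on UNIV (\<lambda>e. run gs e i)"
  using assms
\<comment> \<open>Splitting off the last step expresses the value at \<open>i\<close> through
  finitely many values of the earlier run, so continuity is claimed only one coordinate at a
  time.\<close>
proof (induction gs arbitrary: i rule: rev_induct)
  case Nil
  then show ?case by simp
next
  case (snoc g gs)
  have "continuous_on UNIV (\<lambda>e. run gs e j)" if "j \<in> g i" for j
    using snoc that graphsD(1) [of g i] by auto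
  then have "continuous_on UNIV (\<lambda>e. (1 / real (card (g i))) *\<^sub>R (\<Sum>j\<in>g i. run gs e j))"
    by (intro continuous_on_scaleR continuous_on_const continuous_on_sum)
  then have "continuous_on UNIV (\<lambda>e. p i ((1 / real (card (g i))) *\<^sub>R (\<Sum>j\<in>g i. run gs e j)))"
    by (rule bounded_linear.continuous_on
        [OF bounded_linear_orthogonal_projection [OF proj [OF \<open>i \<in> V\<close>]]])
  then show ?case
    by (simp add: projected_average_def [of p g])
qed

text \<open>A compact substitute for a unit sphere modulo \<open>common\<close>: all norms are at
  most 1, yet no constant configuration with value in \<open>common\<close> is closer than 1/2 in
  the maximum norm.\<close>

definition unit_configs :: "('v \<Rightarrow> 'a) set" where
  "unit_configs = PiE V (\<lambda>i. W i \<inter> cball 0 1)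
     \<inter> {e. \<forall>u\<in>common. \<exists>i\<in>V. 1 / 2 \<le> norm (e i - u)}"

lemma compact_unit_configs: "compact unit_configs"
proof -
  have "{e. \<forall>u\<in>common. \<exists>i\<in>V. 1 / 2 \<le> norm (e i - u)}
      = (\<Inter>u\<in>common. \<Union>i\<in>V. {e. 1 / 2 \<le> norm (e i - u)})"
    by auto
  also have "closed \<dots>"
    by (intro closed_INT ballI closed_UN finite_V closed_Collect_le continuous_on_const
        continuous_on_norm continuous_on_diff continuous_on_product_coordinates)
  finally show ?thesis
    unfolding unit_configs_def
    by (intro compact_Int_closed compact_PiE compact_W)
qed

text \<open>If norm 1 survived, rigidity along the walks from all of \<open>V\<close> would make all
  \<open>e j\<close> equal to one vector. That vector would lie in every \<open>W j\<close>, hence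
  in \<open>common\<close>, at distance 0 from the configuration instead of at least 1/2.\<close>

lemma norm_run_less_1:
  assumes e: "e \<in> unit_configs" and gs: "set gs \<subseteq> graphs" "V \<times> V \<subseteq> walks V gs" and i: "i \<in> V"
  shows "norm (run gs e i) < 1"
proof (rule ccontr)
  assume not_less: "\<not> ?thesis"
  have le: "\<And>j. j \<in> V \<Longrightarrow> norm (e j) \<le> 1" and W: "\<And>j. j \<in> V \<Longrightarrow> e j \<in> W j"
    using e by (auto simp: unit_configs_def)
  have max: "norm (run gs e i) = 1"
    using norm_run_le [OF gs(1), of e 1, OF le i] not_less by simp
  have eq: "e j = run gs e i" if "j \<in> V" for j
    using eq_run_if_norm_maximal [OF gs(1) le i max] gs(2) i that by blast
  then have "run gs e i \<in> common"
    using W by (auto simp: common_def)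
  then obtain j where "j \<in> V" "1 / 2 \<le> norm (e j - run gs e i)"
    using e by (auto simp: unit_configs_def)
  then show False
    using eq by simp
qed

text \<open>For each block and agent the continuous norm attains its maximum on the compact set
  \<open>unit_configs\<close>, and that maximum is below 1. With the length fixed there are finitely
  many such pairs.\<close>

lemma uniform_contraction_unit_configs:
  "\<exists>\<theta>\<ge>1 / 2. \<theta> < 1 \<and> (\<forall>gs e i. set gs \<subseteq> graphs \<longrightarrow> length gs = l \<longrightarrow> V \<times> V \<subseteq> walks V gs \<longrightarrow>
     e \<in> unit_configs \<longrightarrow> i \<in> V \<longrightarrow> norm (run gs e i) \<le> \<theta>)"
proof -
  let ?S = "{gs. set gs \<subseteq> graphs \<and> length gs = l \<and> V \<times> V \<subseteq> walks V gs} \<times> V"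
  have "finite {gs. set gs \<subseteq> graphs \<and> length gs = l}"
    using finite_graphs by (rule finite_lists_length_eq)
  then have "finite ?S"
    using finite_V by (auto elim: rev_finite_subset)
  moreover have "\<exists>\<theta><1. \<forall>e\<in>unit_configs. norm (run (fst s) e (snd s)) \<le> \<theta>" if "s \<in> ?S" for s
  proof (cases "unit_configs = {}")
    case True
    then show ?thesis by (intro exI [of _ 0]) simp
  next
    case False
    have s: "set (fst s) \<subseteq> graphs" "V \<times> V \<subseteq> walks V (fst s)" "snd s \<in> V"
      using that by auto
    have "continuous_on unit_configs (\<lambda>e. norm (run (fst s) e (snd s)))"
      using continuous_on_run [OF s(1,3)] by (auto intro: continuous_on_norm continuous_on_subset)
    then obtain e where "e \<in> unit_configs"
      "\<forall>e'\<in>unit_configs. norm (run (fst s) e' (snd s)) \<le> norm (run (fst s) e (snd s))"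
      using continuous_attains_sup [OF compact_unit_configs False] by blast
    then show ?thesis
      using norm_run_less_1 [OF _ s] by blast
  qed
  ultimately obtain \<theta> where "\<theta> \<ge> 1 / 2" "\<theta> < 1"
    "\<forall>s\<in>?S. \<forall>e\<in>unit_configs. norm (run (fst s) e (snd s)) \<le> \<theta>"
    using uniform_bound_below_1 [of ?S unit_configs "\<lambda>s e. norm (run (fst s) e (snd s))"] by blast
  then show ?thesis by (intro exI [of _ \<theta>]) force
qed

text \<open>A bound on the maximum-norm distance to the constant configurations with value in
  \<open>common\<close>, given by a witness rather than an infimum.\<close>

definition near :: "('v \<Rightarrow> 'a) \<Rightarrow> real \<Rightarrow> bool" where
  "near e r \<longleftrightarrow> (\<exists>u\<in>common. \<forall>i\<in>V. norm (e i - u) \<le> r)"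

lemma norm_run_diff_le:
  assumes gs: "set gs \<subseteq> graphs" and u: "u \<in> common" and le: "\<And>j. j \<in> V \<Longrightarrow> norm (e j - u) \<le> r"
    and i: "i \<in> V"
  shows "norm (run gs e i - u) \<le> r"
proof -
  have "run gs (\<lambda>j. e j - u) i = 1 *\<^sub>R (run gs e i - u)"
    by (rule run_affine [OF gs u _ i]) simp
  then show ?thesis
    using norm_run_le [OF gs, of "\<lambda>j. e j - u", OF le i] by simp
qed

lemma near_run: "set gs \<subseteq> graphs \<Longrightarrow> near e r \<Longrightarrow> near (run gs e) r"
  unfolding near_def by (meson norm_run_diff_le)

text \<open>Affine equivariance carries the bound on \<open>unit_configs\<close> to every centre and
  radius, so \<theta> depends on the block length \<open>l\<close> alone.\<close>

lemma uniform_contraction: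
  obtains \<theta> where "\<theta> \<ge> 1 / 2" "\<theta> < 1"
    "\<And>gs e r. set gs \<subseteq> graphs \<Longrightarrow> length gs = l \<Longrightarrow> V \<times> V \<subseteq> walks V gs \<Longrightarrow>
       (\<And>j. j \<in> V \<Longrightarrow> e j \<in> W j) \<Longrightarrow> r > 0 \<Longrightarrow> near e r \<Longrightarrow> near (run gs e) (\<theta> * r)"
proof -
  obtain \<theta> where \<theta>: "\<theta> \<ge> 1 / 2" "\<theta> < 1" and bound:
    "\<And>gs e i. set gs \<subseteq> graphs \<Longrightarrow> length gs = l \<Longrightarrow> V \<times> V \<subseteq> walks V gs \<Longrightarrow>
       e \<in> unit_configs \<Longrightarrow> i \<in> V \<Longrightarrow> norm (run gs e i) \<le> \<theta>"
    using uniform_contraction_unit_configs [of l] by blast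
  have "near (run gs e) (\<theta> * r)"
    if gs: "set gs \<subseteq> graphs" "length gs = l" "V \<times> V \<subseteq> walks V gs"
      and W: "\<And>j. j \<in> V \<Longrightarrow> e j \<in> W j" and r: "r > 0" and near: "near e r" for gs e r
  \<comment> \<open>If \<open>near e (r / 2)\<close> fails, recentring at \<open>u\<close> and scaling by \<open>1 / r\<close> lands in
    \<open>unit_configs\<close>; a nearest point of \<open>common\<close> is never needed.\<close>
  proof (cases "near e (r / 2)")
    case True
    then have "near (run gs e) (r / 2)"
      by (rule near_run [OF gs(1)])
    moreover have "r / 2 \<le> \<theta> * r"
      using \<theta>(1) r by (simp add: field_simps)
    ultimately show ?thesis
      unfolding near_def by (meson order_trans)
  next
    case False
    obtain u where u: "u \<in> common" "\<And>i. i \<in> V \<Longrightarrow> norm (e i - u) \<le> r"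
      using near by (auto simp: near_def)
    \<comment> \<open>Restriction puts \<open>e'\<close> into the extensional product underlying
      \<open>unit_configs\<close>; runs see only its values on \<open>V\<close>.\<close>
    define e' where "e' = restrict (\<lambda>i. (1 / r) *\<^sub>R (e i - u)) V"
    have e'_in: "e' i \<in> W i \<inter> cball 0 1" if "i \<in> V" for i
    proof
      have "Real_Vector_Spaces.subspace (W i)"
        using proj [OF that] by (simp add: orthogonal_projection_onto_def)
      then show "e' i \<in> W i"
        using that W u(1) by (simp add: e'_def common_def subspace_diff subspace_scale)
      have "norm (e' i) = norm (e i - u) / r"
        using that r by (simp add: e'_def)
      then show "e' i \<in> cball 0 1"
        using u(2) [OF that] r by simp
    qed
    have "\<exists>i\<in>V. 1 / 2 \<le> norm (e' i - u')" if u': "u' \<in> common" for u'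
    proof (rule ccontr)
      assume small: "\<not> ?thesis"
      \<comment> \<open>Undoing the normalization turns a vector \<open>u'\<close> too close to
        \<open>e'\<close> into the witness \<open>u + r *\<^sub>R u'\<close> for
        \<open>near e (r / 2)\<close>, which was excluded.\<close>
      have "norm (e i - (u + r *\<^sub>R u')) \<le> r / 2" if i: "i \<in> V" for i
      proof -
        have "e i - (u + r *\<^sub>R u') = r *\<^sub>R (e' i - u')"
          using i r by (simp add: e'_def scaleR_diff_right)
        then have "norm (e i - (u + r *\<^sub>R u')) = r * norm (e' i - u')"
          using r by simp
        also have "\<dots> \<le> r * (1 / 2)"
          using small i r by (intro mult_left_mono) (auto simp: not_le less_imp_le)
        finally show ?thesis by simp
      qed
      moreover have "u + r *\<^sub>R u' \<in> common"
        using u(1) u' proj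
        by (auto simp: common_def orthogonal_projection_onto_def intro!: subspace_add subspace_scale)
      ultimately show False
        using False by (auto simp: near_def)
    qed
    with e'_in have e': "e' \<in> unit_configs"
      by (auto simp: unit_configs_def e'_def)
    have "norm (run gs e i - u) \<le> \<theta> * r" if i: "i \<in> V" for i
    proof -
      have "run gs e' i = (1 / r) *\<^sub>R (run gs e i - u)"
        by (rule run_affine [OF gs(1) u(1) _ i]) (simp add: e'_def)
      then have "norm (run gs e' i) = norm (run gs e i - u) / r"
        using r by simp
      then show ?thesis
        using bound [OF gs e' i] r by (simp add: pos_divide_le_eq)
    qed
    then show ?thesis
      using u(1) by (auto simp: near_def)
  qed
  with \<theta> show thesis by (rule that)
qed

section \<open>Convergence at a geometric rate\<close>

lemma dist_common_le:
  assumes v: "v \<in> common" and i: "i \<in> V"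
  shows "norm (u - p i u) \<le> norm (u - v)"
proof -
  \<comment> \<open>Since \<open>v\<close> is fixed by \<open>p i\<close>, the residuals of
    \<open>u\<close> and of \<open>u - v\<close> coincide.\<close>
  have "p i (u - v) = p i u - v"
    using proj [OF i] v i
    by (auto simp: orthogonal_projection_onto_def common_def linear_diff
        intro: orthogonal_projection_id)
  then show ?thesis
    using norm_orthogonal_projection_residual_le [OF proj [OF i], of "u - v"] by simp
qed

text \<open>Each block shrinks the distance to the common subspace by \<theta>, but the
  approximating vector \<open>v k\<close> may change with \<open>k\<close>. Nonexpansiveness around
  each \<open>v k\<close> and a cluster point of the errors yield one limit for all times.\<close>

lemma geometric_convergence:
  fixes g :: "nat \<Rightarrow> 'v \<Rightarrow> 'v set" and e :: "nat \<Rightarrow> 'v \<Rightarrow> 'a"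
  assumes g: "\<And>t. g t \<in> graphs"
    and init: "\<And>i. i \<in> V \<Longrightarrow> e 0 i \<in> W i"
    and update: "\<And>t i. i \<in> V \<Longrightarrow> e (Suc t) i = projected_average p (g t) (e t) i"
    and L: "L > 0"
    and conn: "\<And>k. V \<times> V \<subseteq> walks V (map g [T + k * L..<T + Suc k * L])"
  shows "\<exists>u\<in>common. \<exists>\<rho>>0. \<rho> < 1 \<and> (\<exists>c. \<forall>t. \<forall>i\<in>V. norm (e t i - u) \<le> c * \<rho> ^ t)"
proof -
  have e_run: "e t i = run (map g [s..<t]) (e s) i" if "s \<le> t" "i \<in> V" for s t i
    using that
  proof (induction t arbitrary: i rule: dec_induct)
    case (step t)
    have "projected_average p (g t) (e t) i = projected_average p (g t) (run (map g [s..<t]) (e s)) i"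
      using step.IH by (rule step_cong [OF g _ step.prems])
    then show ?case
      using step by (simp add: update)
  qed simp
  have graphs: "set (map g ts) \<subseteq> graphs" for ts
    using g by auto
  have e_W: "e t i \<in> W i" if "i \<in> V" for t i
    using e_run [of 0 t i] run_in_W [of "e 0" i] init that by simp
  have later: "norm (e t i - u) \<le> r"
    if "u \<in> common" "\<And>j. j \<in> V \<Longrightarrow> norm (e s j - u) \<le> r" "s \<le> t" "i \<in> V" for u r s t i
    using norm_run_diff_le [OF graphs, of u "e s" r i] e_run that by simp

  \<comment> \<open>The summand 1 keeps \<open>C\<close> positive even for zero errors, as needed
    for the radii in \<open>contract\<close> and for scaling by \<open>1 / C\<close>.\<close>
  define C where "C = 1 + (\<Sum>i\<in>V. norm (e 0 i))"
  have C: "C > 0"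
    by (simp add: C_def add_pos_nonneg sum_nonneg)
  have e0: "norm (e 0 i) \<le> C" if "i \<in> V" for i
  proof -
    have "norm (e 0 i) \<le> (\<Sum>i\<in>V. norm (e 0 i))"
      by (rule member_le_sum) (use that finite_V in auto)
    then show ?thesis by (simp add: C_def)
  qed
  have e_C: "norm (e t i) \<le> C" if "i \<in> V" for t i
    using later [of 0 0 C t i] e0 zero_common that by simp

  obtain \<theta> where \<theta>: "\<theta> \<ge> 1 / 2" "\<theta> < 1" and contract:
    "\<And>gs e r. set gs \<subseteq> graphs \<Longrightarrow> length gs = L \<Longrightarrow> V \<times> V \<subseteq> walks V gs \<Longrightarrow>
       (\<And>j. j \<in> V \<Longrightarrow> e j \<in> W j) \<Longrightarrow> r > 0 \<Longrightarrow> near e r \<Longrightarrow> near (run gs e) (\<theta> * r)"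
    using uniform_contraction [of L] by blast
  have near: "near (e (T + k * L)) (C * \<theta> ^ k)" for k
  proof (induction k)
    case 0
    then show ?case
      using e_C zero_common by (auto simp: near_def intro!: bexI [of _ 0])
  next
    case (Suc k)
    let ?gs = "map g [T + k * L..<T + Suc k * L]"
    have "near (run ?gs (e (T + k * L))) (\<theta> * (C * \<theta> ^ k))"
      by (rule contract [OF graphs _ conn e_W _ Suc.IH]) (use C \<theta> in auto)
    moreover have "e (T + Suc k * L) i = run ?gs (e (T + k * L)) i" if "i \<in> V" for i
      by (rule e_run) (use that in auto)
    ultimately show ?case
      by (simp add: near_def mult.left_commute)
  qed
  then have "\<forall>k. \<exists>u. u \<in> common \<and> (\<forall>i\<in>V. norm (e (T + k * L) i - u) \<le> C * \<theta> ^ k)"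
    by (auto simp: near_def)
  then obtain v where v_common: "\<And>k. v k \<in> common"
    and v_block: "\<And>k i. i \<in> V \<Longrightarrow> norm (e (T + k * L) i - v k) \<le> C * \<theta> ^ k"
    by metis
  \<comment> \<open>The bound reached at the start of block \<open>k\<close> persists at all later
    times, also inside blocks.\<close>
  have v: "norm (e t i - v k) \<le> C * \<theta> ^ k" if "i \<in> V" "T + k * L \<le> t" for t i k
    by (rule later [OF v_common _ that(2,1)]) (rule v_block)
  have \<theta>_0: "(\<lambda>k. C * \<theta> ^ k) \<longlonglongrightarrow> 0"
    using tendsto_mult_right_zero [OF LIMSEQ_power_zero [of \<theta>], of C] \<theta> by simp

  \<comment> \<open>A cluster point of a single agent's errors is already the limit for all agents, as it is
    within \<open>C * \<theta> ^ k\<close> of every \<open>v k\<close>.\<close>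
  obtain i0 where i0: "i0 \<in> V"
    using V_nonempty by blast
  have "\<forall>t. (1 / C) *\<^sub>R e t i0 \<in> W i0 \<inter> cball 0 1"
    using e_W [OF i0] e_C [OF i0] C proj [OF i0]
    by (auto simp: orthogonal_projection_onto_def subspace_scale)
  then obtain l r where l: "strict_mono r" "((\<lambda>t. (1 / C) *\<^sub>R e t i0) \<circ> r) \<longlonglongrightarrow> l"
    using compact_W [OF i0] unfolding compact_def by metis
  define u where "u = C *\<^sub>R l"
  have "(\<lambda>n. C *\<^sub>R ((\<lambda>t. (1 / C) *\<^sub>R e t i0) \<circ> r) n) \<longlonglongrightarrow> u"
    unfolding u_def by (intro tendsto_scaleR tendsto_const l)
  then have lim: "(\<lambda>n. e (r n) i0) \<longlonglongrightarrow> u"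
    using C by simp
  have u_v: "norm (u - v k) \<le> C * \<theta> ^ k" for k
  proof (rule tendsto_upperbound)
    show "(\<lambda>n. norm (e (r n) i0 - v k)) \<longlonglongrightarrow> norm (u - v k)"
      by (intro tendsto_norm tendsto_diff lim tendsto_const)
    show "\<forall>\<^sub>F n in sequentially. norm (e (r n) i0 - v k) \<le> C * \<theta> ^ k"
      using eventually_ge_at_top [of "T + k * L"]
    proof eventually_elim
      case (elim n)
      then show ?case
        using v [OF i0, of k "r n"] seq_suble [OF l(1), of n] by simp
    qed
  qed simp
  \<comment> \<open>The residual of \<open>u\<close> is at most its distance to \<open>v k\<close>
    for every \<open>k\<close>, hence zero.\<close>
  have "u \<in> W i" if i: "i \<in> V" for i
  proof -
    have "norm (u - p i u) \<le> C * \<theta> ^ k" for k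
      using dist_common_le [OF v_common i, of u k] u_v [of k] by simp
    then have "norm (u - p i u) \<le> 0"
      by (intro LIMSEQ_le_const [OF \<theta>_0]) auto
    moreover have "p i u \<in> W i"
      using proj [OF i] by (simp add: orthogonal_projection_onto_def)
    ultimately show ?thesis by simp
  qed
  then have u: "u \<in> common"
    by (simp add: common_def)

  \<comment> \<open>The \<open>L\<close>-th root converts the factor per block into a factor per
    step.\<close>
  define \<rho> where "\<rho> = root L \<theta>"
  have \<rho>: "\<rho> > 0" "\<rho> < 1" "\<rho> ^ L = \<theta>"
    using \<theta> L by (auto simp: \<rho>_def real_root_pow_pos2)
  have "norm (e t i - u) \<le> 2 * C / \<rho> ^ (T + L) * \<rho> ^ t" if i: "i \<in> V" for t i
  proof -
    \<comment> \<open>\<open>k\<close> counts the complete blocks since \<open>T\<close>. Truncated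
      subtraction gives \<open>k = 0\<close> before \<open>T\<close>, where both norms are at most
      \<open>C\<close>. The factor 2 comes from the triangle inequality, and division by
      \<open>\<rho> ^ (T + L)\<close> pays for the initial time and the unfinished block.\<close>
    define k where "k = (t - T) div L"
    have "norm (e t i - u) \<le> 2 * (C * \<theta> ^ k)"
    proof (cases "T \<le> t")
      case True
      have "T + k * L \<le> t"
        using True div_times_less_eq_dividend [of "t - T" L] unfolding k_def by linarith
      then have "norm (e t i - v k) + norm (u - v k) \<le> 2 * (C * \<theta> ^ k)"
        using v [OF i] u_v [of k] by fastforce
      then show ?thesis
        using norm_triangle_ineq4 [of "e t i - v k" "u - v k"] by simp
    next
      case False
      have "norm u \<le> C"
        by (rule tendsto_upperbound [OF tendsto_norm [OF lim]]) (use e_C [OF i0] in auto)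
      then show ?thesis
        using False norm_triangle_ineq4 [of "e t i" u] e_C [OF i, of t] by (simp add: k_def)
    qed
    moreover have "\<theta> ^ k * \<rho> ^ (T + L) \<le> \<rho> ^ t"
    proof -
      have "t - T < L * k + L"
        using dividend_less_times_div [OF L, of "t - T"] by (simp add: k_def)
      then have "t \<le> L * k + (T + L)"
        by simp
      moreover have "\<theta> ^ k * \<rho> ^ (T + L) = \<rho> ^ (L * k + (T + L))"
        by (simp add: power_add power_mult \<rho>(3))
      ultimately show ?thesis
        using \<rho> by (simp add: power_decreasing)
    qed
    then have "2 * (C * \<theta> ^ k) \<le> 2 * C / \<rho> ^ (T + L) * \<rho> ^ t"
      using C \<rho>(1) by (simp add: pos_le_divide_eq mult.assoc mult.left_commute)
    ultimately show ?thesis by simp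
  qed
  then show ?thesis
    using u \<rho> by blast
qed

end

section \<open>Joint connectivity\<close>

lemma walks_append: "walks V (gs @ hs) = walks V gs O walks V hs"
  by (induction gs) auto

lemma walks_concat: "walks V (concat gss) = foldr (O) (map (walks V) gss) Id"
  by (induction gss) (simp_all add: walks_append)

lemma walks_restrict: "walks V (map (\<lambda>t. restrict (h t) V) ts) = walks V (map h ts)"
  by (induction ts) auto

lemma Id_on_subset_walks:
  "(\<And>g i. g \<in> set gs \<Longrightarrow> i \<in> V \<Longrightarrow> i \<in> g i) \<Longrightarrow> Id_on V \<subseteq> walks V gs"
proof (induction gs)
  case (Cons g gs)
  then have "Id_on V \<subseteq> {(j, i). i \<in> V \<and> j \<in> g i}" "Id_on V \<subseteq> walks V gs"
    by auto
  then show ?case by auto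
qed auto

text \<open>The list must be nonempty because \<open>walks V []\<close> is the identity on the whole
  type, not on \<open>V\<close>.\<close>

lemma walks_subset:
  "gs \<noteq> [] \<Longrightarrow> (\<And>g i. g \<in> set gs \<Longrightarrow> i \<in> V \<Longrightarrow> g i \<subseteq> V) \<Longrightarrow> walks V gs \<subseteq> V \<times> V"
proof (induction gs)
  case (Cons g gs)
  then show ?case by (cases "gs = []") fastforce+
qed simp

lemma foldr_relcomp_full:
  assumes V: "finite V"
    and R: "\<And>R. R \<in> set Rs \<Longrightarrow> Id_on V \<subseteq> R \<and> R \<subseteq> V \<times> V \<and> V \<times> V \<subseteq> R\<^sup>*"
    and len: "card V \<le> length Rs"
  shows "V \<times> V \<subseteq> foldr (O) Rs Id"
proof -
  \<comment> \<open>Each factor enlarges the set of predecessors of \<open>i\<close> until it is all of \<open>V\<close>.\<close>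
  let ?S = "\<lambda>Rs i. {j. (j, i) \<in> foldr (O) Rs Id}"
  have grow: "?S Rs i \<subseteq> V \<and> i \<in> ?S Rs i \<and> min (card V) (length Rs) \<le> card (?S Rs i)"
    if "i \<in> V" "\<And>R. R \<in> set Rs \<Longrightarrow> Id_on V \<subseteq> R \<and> R \<subseteq> V \<times> V \<and> V \<times> V \<subseteq> R\<^sup>*" for Rs i
    using that(2)
  proof (induction Rs)
    case Nil
    then show ?case using \<open>i \<in> V\<close> by simp
  next
    case (Cons R Rs)
    define S where "S = ?S Rs i"
    have IH: "S \<subseteq> V" "i \<in> S" "min (card V) (length Rs) \<le> card S"
      using Cons unfolding S_def by auto
    have R: "Id_on V \<subseteq> R" "R \<subseteq> V \<times> V" "V \<times> V \<subseteq> R\<^sup>*"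
      using Cons.prems by auto
    have S': "?S (R # Rs) i = {j. \<exists>k\<in>S. (j, k) \<in> R}"
      unfolding S_def by auto
    have sub: "S \<subseteq> ?S (R # Rs) i" "?S (R # Rs) i \<subseteq> V"
      unfolding S' using R(1,2) IH(1) by (blast intro: Id_onI)+
    have fin: "finite (?S (R # Rs) i)"
      using finite_subset [OF sub(2) V] .
    have "min (card V) (length (R # Rs)) \<le> card (?S (R # Rs) i)"
    proof (cases "S = V")
      case True
      then show ?thesis using sub by (simp add: subset_antisym)
    next
      case False
      then obtain v where v: "v \<in> V" "v \<notin> S"
        using IH(1) by blast
      have "(v, i) \<in> R\<^sup>*"
        using R(3) v \<open>i \<in> V\<close> by auto
      \<comment> \<open>A path from \<open>v\<close> outside \<open>S\<close> to \<open>i\<close>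
        inside \<open>S\<close> must cross into \<open>S\<close>; the tail of the crossing arc is
        the new predecessor.\<close>
      then have "\<exists>a b. (a, b) \<in> R \<and> a \<notin> S \<and> b \<in> S"
        using v(2) IH(2) by (induction rule: converse_rtrancl_induct) auto
      then have "S \<subset> ?S (R # Rs) i"
        using sub(1) unfolding S' by blast
      then have "card S < card (?S (R # Rs) i)"
        using fin by (simp only: psubset_card_mono)
      then show ?thesis using IH(3) by simp
    qed
    then show ?case
      using sub IH(2) by blast
  qed
  show ?thesis
  proof
    fix a assume "a \<in> V \<times> V"
    then obtain j i where a: "a = (j, i)" "i \<in> V" "j \<in> V" by auto
    have "?S Rs i \<subseteq> V" "card V \<le> card (?S Rs i)"
      using grow [OF a(2), of Rs] R len by (auto simp: min_def split: if_splits)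
    then have "?S Rs i = V"
      using V by (simp add: card_seteq)
    with a show "a \<in> foldr (O) Rs Id" by auto
  qed
qed

text \<open>The accumulator of the fold is traversed first, so it stays the left factor of the
  relational composition. Generalizing over it makes the induction work.\<close>

lemma walks_comp_interval:
  assumes "s \<le> e"
  shows "parcs (comp_interval (\<lambda>t. neighbor_graph m (h t)) s e) = walks {1..m} (map h [s..<Suc e])"
    and "pverts (comp_interval (\<lambda>t. neighbor_graph m (h t)) s e) = {1..m}"
proof -
  have "parcs (fold (\<lambda>t H. comp_digraph (neighbor_graph m (h t)) H) ts H)
      = parcs H O walks {1..m} (map h ts)" for ts H
    by (induction ts arbitrary: H) (simp_all add: comp_digraph_def neighbor_graph_def O_assoc)
  then show "parcs (comp_interval (\<lambda>t. neighbor_graph m (h t)) s e) = walks {1..m} (map h [s..<Suc e])"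
    using assms
    by (simp add: comp_interval_def upt_conv_Cons neighbor_graph_def del: upt_Suc)
  have "pverts (fold (\<lambda>t H. comp_digraph (neighbor_graph m (h t)) H) ts H) = {1..m}"
    if "pverts H = {1..m}" for ts H
    using that
    by (induction ts arbitrary: H) (simp_all add: comp_digraph_def neighbor_graph_def)
  then show "pverts (comp_interval (\<lambda>t. neighbor_graph m (h t)) s e) = {1..m}"
    by (simp add: comp_interval_def neighbor_graph_def)
qed

lemma strongly_connected_with_projD:
  assumes "strongly_connected (with_proj G)"
  shows "pverts G \<times> pverts G \<subseteq> (parcs G)\<^sup>*"
proof -
  have "arcs_ends (with_proj G) = parcs G"
    by (auto simp: arcs_ends_def arc_to_ends_def)
  moreover have "u \<rightarrow>\<^sup>*\<^bsub>with_proj G\<^esub> v" if "u \<in> pverts G" "v \<in> pverts G" for u v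
    using assms that by (simp add: strongly_connected_def)
  ultimately show ?thesis
    using reachable_rtranclI [of "with_proj G"] by auto
qed

lemma concat_consecutive_upt:
  "concat (map (\<lambda>q. [a + q * l..<a + Suc q * l]) [0..<k]) = [a..<a + k * l]"
proof (induction k)
  case (Suc k)
  then show ?case
    using upt_add_eq_append [of a "a + k * l" l] by (simp add: add_ac upt_Suc_append del: upt_Suc)
qed simp

text \<open>One period gives only a strongly connected composition. Self-arcs let \<open>m\<close>
  consecutive periods accumulate until every pair of vertices is related, hence
  \<open>L = m * l\<close>.\<close>

lemma repeatedly_jointly_strongly_connected_walks:
  assumes conn: "repeatedly_jointly_strongly_connected (\<lambda>t. neighbor_graph m (h t))"
    and h: "\<And>i t. i \<in> {1..m} \<Longrightarrow> t \<ge> 1 \<Longrightarrow> h t i \<subseteq> {1..m} \<and> i \<in> h t i" and m: "m > 0"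
  obtains L T where "L > 0" "T > 0"
    "\<And>k. {1..m} \<times> {1..m} \<subseteq> walks {1..m} (map h [T + k * L..<T + Suc k * L])"
proof -
  obtain l T where lT: "l > 0" "T > 0" and sc:
    "\<And>k. k > 0 \<Longrightarrow> strongly_connected
      (with_proj (comp_interval (\<lambda>t. neighbor_graph m (h t)) ((k - 1) * l + T) (k * l + T - 1)))"
    using conn by (auto simp: repeatedly_jointly_strongly_connected_def)
  define block where "block q = walks {1..m} (map h [T + q * l..<T + Suc q * l])" for q
  have block: "Id_on {1..m} \<subseteq> block q \<and> block q \<subseteq> {1..m} \<times> {1..m} \<and> {1..m} \<times> {1..m} \<subseteq> (block q)\<^sup>*" for q
  proof (intro conjI)
    show "Id_on {1..m} \<subseteq> block q"
      unfolding block_def by (intro Id_on_subset_walks) (use h lT in auto)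
    show "block q \<subseteq> {1..m} \<times> {1..m}"
      unfolding block_def
    proof (rule walks_subset)
      show "map h [T + q * l..<T + Suc q * l] \<noteq> []"
        using lT by simp
      fix g i assume g: "g \<in> set (map h [T + q * l..<T + Suc q * l])" and i: "i \<in> {1..m}"
      from g obtain t where "g = h t" "T + q * l \<le> t"
        by auto
      then show "g i \<subseteq> {1..m}"
        using h [OF i, of t] lT(2) by simp
    qed
    have le: "q * l + T \<le> Suc q * l + T - 1"
      using lT by simp
    let ?G = "comp_interval (\<lambda>t. neighbor_graph m (h t)) (q * l + T) (Suc q * l + T - 1)"
    \<comment> \<open>Periods are counted from 1 with an inclusive end in the definition of joint
      connectivity, but from 0 with an exclusive end in \<open>block\<close>.\<close>
    have "Suc (Suc q * l + T - 1) = T + Suc q * l"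
      using lT by simp
    then have "parcs ?G = block q"
      unfolding walks_comp_interval(1) [OF le] block_def by (simp add: add.commute del: upt_Suc)
    moreover have "pverts ?G = {1..m}"
      by (rule walks_comp_interval(2) [OF le])
    moreover have "strongly_connected (with_proj ?G)"
      using sc [of "Suc q"] by (simp only: diff_Suc_1 zero_less_Suc)
    ultimately show "{1..m} \<times> {1..m} \<subseteq> (block q)\<^sup>*"
      using strongly_connected_with_projD by metis
  qed
  have "{1..m} \<times> {1..m} \<subseteq> walks {1..m} (map h [T + k * (m * l)..<T + Suc k * (m * l)])" for k
  proof -
    let ?blocks = "map (\<lambda>q. [T + k * (m * l) + q * l..<T + k * (m * l) + Suc q * l]) [0..<m]"
    have "map h [T + k * (m * l)..<T + Suc k * (m * l)] = concat (map (map h) ?blocks)"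
      using concat_consecutive_upt [of "T + k * (m * l)" l m, symmetric]
      by (simp add: map_concat add_ac del: upt_Suc)
    moreover have "{1..m} \<times> {1..m} \<subseteq> foldr (O) (map (walks {1..m}) (map (map h) ?blocks)) Id"
    proof (rule foldr_relcomp_full)
      fix R assume "R \<in> set (map (walks {1..m}) (map (map h) ?blocks))"
      then obtain q where "R = walks {1..m} (map h [T + k * (m * l) + q * l..<T + k * (m * l) + Suc q * l])"
        by auto
      \<comment> \<open>Period \<open>q\<close> inside the long block \<open>k\<close> is period
        \<open>k * m + q\<close> of the whole sequence.\<close>
      then have "R = block (k * m + q)"
        by (simp add: block_def algebra_simps del: upt_Suc)
      then show "Id_on {1..m} \<subseteq> R \<and> R \<subseteq> {1..m} \<times> {1..m} \<and> {1..m} \<times> {1..m} \<subseteq> R\<^sup>*"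
        using block by simp
    qed simp_all
    ultimately show ?thesis
      by (simp only: walks_concat)
  qed
  then show thesis
    using that [of "m * l" T] lT m by simp
qed

section \<open>Real vectors as finitely supported functions\<close>

definition emb :: "real vec \<Rightarrow> nat \<Rightarrow>\<^sub>0 real" where
  "emb v = Abs_poly_mapping (\<lambda>k. if k < dim_vec v then v $ k else 0)"

definition unemb :: "nat \<Rightarrow> (nat \<Rightarrow>\<^sub>0 real) \<Rightarrow> real vec" where
  "unemb n f = vec n (Poly_Mapping.lookup f)"

lemma lookup_emb: "Poly_Mapping.lookup (emb v) k = (if k < dim_vec v then v $ k else 0)"
proof -
  have "finite {k. (if k < dim_vec v then v $ k else 0) \<noteq> 0}"
    by (rule finite_subset [of _ "{..<dim_vec v}"]) auto
  then show ?thesis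
    by (simp add: emb_def)
qed

lemma unemb_carrier [simp]: "unemb n f \<in> carrier_vec n"
  by (simp add: unemb_def)

lemma dim_unemb [simp]: "dim_vec (unemb n f) = n"
  by (simp add: unemb_def)

lemma unemb_emb: "v \<in> carrier_vec n \<Longrightarrow> unemb n (emb v) = v"
  by (intro eq_vecI) (auto simp: unemb_def lookup_emb)

lemma emb_zero [simp]: "emb (0\<^sub>v n) = 0"
  by (rule poly_mapping_eqI) (simp add: lookup_emb)

lemma emb_add: "v \<in> carrier_vec n \<Longrightarrow> w \<in> carrier_vec n \<Longrightarrow> emb (v + w) = emb v + emb w"
  by (rule poly_mapping_eqI) (auto simp: lookup_emb lookup_add)

lemma emb_diff: "v \<in> carrier_vec n \<Longrightarrow> w \<in> carrier_vec n \<Longrightarrow> emb (v - w) = emb v - emb w"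
  by (rule poly_mapping_eqI) (auto simp: lookup_emb lookup_minus)

lemma emb_smult: "emb (r \<cdot>\<^sub>v v) = r *\<^sub>R emb v"
  by (rule poly_mapping_eqI) (auto simp: lookup_emb)

lemma unemb_add: "unemb n (f + g) = unemb n f + unemb n g"
  by (intro eq_vecI) (auto simp: unemb_def lookup_add)

lemma unemb_diff: "unemb n (f - g) = unemb n f - unemb n g"
  by (intro eq_vecI) (auto simp: unemb_def lookup_minus)

lemma unemb_scaleR: "unemb n (r *\<^sub>R f) = r \<cdot>\<^sub>v unemb n f"
  by (intro eq_vecI) (auto simp: unemb_def)

lemma inner_emb: "w \<in> carrier_vec n \<Longrightarrow> inner f (emb w) = scalar_prod (unemb n f) w"
  by (subst inner_poly_mapping_eq_sum [of "{0..<n}"])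
    (auto simp: lookup_emb scalar_prod_def unemb_def intro!: sum.cong split: if_splits)

lemma norm_emb: "norm (emb v) = vec_norm2 v"
proof -
  have "inner (emb v) (emb v) = scalar_prod v v"
    by (subst inner_emb [of v "dim_vec v"]) (auto simp: unemb_emb)
  then show ?thesis
    by (simp add: norm_eq_sqrt_inner vec_norm2_def L2_set_def scalar_prod_def power2_eq_square
        lessThan_atLeast0)
qed

text \<open>Truncation to the first \<open>n\<close> coordinates discards only components orthogonal
  to every embedded vector of length \<open>n\<close>. Following it by \<open>P\<close> therefore
  projects the whole space orthogonally.\<close>

lemma orthogonal_projection_onto_emb_kernel:
  assumes A: "A \<in> carrier_mat r n" and P: "is_orthogonal_projection n (mat_kernel A) P"
  shows "orthogonal_projection_onto (emb ` mat_kernel A) (\<lambda>f. emb (P *\<^sub>v unemb n f))"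
proof -
  have ker_carrier: "mat_kernel A \<subseteq> carrier_vec n"
    using mat_kernelD(1) [OF A] by blast
  have P_carrier: "P \<in> carrier_mat n n" and
    P_ker: "\<And>v. v \<in> carrier_vec n \<Longrightarrow> P *\<^sub>v v \<in> mat_kernel A" and
    P_orth: "\<And>v w. v \<in> carrier_vec n \<Longrightarrow> w \<in> mat_kernel A \<Longrightarrow> scalar_prod (v - P *\<^sub>v v) w = 0"
    using P by (auto simp: is_orthogonal_projection_def)
  have "Real_Vector_Spaces.subspace (emb ` mat_kernel A)"
  proof (rule subspaceI)
    have "0\<^sub>v n \<in> mat_kernel A"
      using A by (intro mat_kernelI [OF A]) auto
    then show "0 \<in> emb ` mat_kernel A"
      by (metis emb_zero imageI)
  next
    fix f g assume "f \<in> emb ` mat_kernel A" "g \<in> emb ` mat_kernel A"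
    then obtain v w where vw: "v \<in> mat_kernel A" "w \<in> mat_kernel A" "f = emb v" "g = emb w"
      by auto
    have "v + w \<in> mat_kernel A"
      using mat_kernelD [OF A vw(1)] mat_kernelD [OF A vw(2)]
      by (intro mat_kernelI [OF A]) (auto simp: mult_add_distrib_mat_vec [OF A])
    moreover have "f + g = emb (v + w)"
      using vw ker_carrier by (simp add: emb_add [of v n w] subset_iff)
    ultimately show "f + g \<in> emb ` mat_kernel A"
      by simp
  next
    fix c f assume "f \<in> emb ` mat_kernel A"
    then obtain v where v: "v \<in> mat_kernel A" "f = emb v"
      by auto
    have "c \<cdot>\<^sub>v v \<in> mat_kernel A"
      using mat_kernelD [OF A v(1)]
      by (intro mat_kernelI [OF A]) (auto simp: mult_mat_vec [OF A])
    then show "c *\<^sub>R f \<in> emb ` mat_kernel A"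
      using v by (auto simp flip: emb_smult)
  qed
  moreover have "Real_Vector_Spaces.linear (\<lambda>f. emb (P *\<^sub>v unemb n f))"
  proof (rule linearI)
    fix f g :: "nat \<Rightarrow>\<^sub>0 real" and c :: real
    show "emb (P *\<^sub>v unemb n (f + g)) = emb (P *\<^sub>v unemb n f) + emb (P *\<^sub>v unemb n g)"
      using P_carrier
      by (simp add: unemb_add mult_add_distrib_mat_vec [OF P_carrier] emb_add [of _ n])
    show "emb (P *\<^sub>v unemb n (c *\<^sub>R f)) = c *\<^sub>R emb (P *\<^sub>v unemb n f)"
      by (simp add: unemb_scaleR mult_mat_vec [OF P_carrier] emb_smult)
  qed
  moreover have "inner (f - emb (P *\<^sub>v unemb n f)) (emb w) = 0" if "w \<in> mat_kernel A" for f w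
  proof -
    have "P *\<^sub>v unemb n f \<in> carrier_vec n"
      using P_carrier by simp
    then show ?thesis
      using inner_emb [of w n] P_orth [OF unemb_carrier that] that ker_carrier
      by (auto simp: unemb_diff unemb_emb)
  qed
  ultimately show ?thesis
    using P_ker by (auto simp: orthogonal_projection_onto_def)
qed

lemma compact_emb_kernel:
  assumes A: "A \<in> carrier_mat r n" and P: "is_orthogonal_projection n (mat_kernel A) P"
  shows "compact (emb ` mat_kernel A \<inter> cball 0 1)"
proof (rule compact_finitely_supported [of _ 1 "{..<n}"])
  show "closed (emb ` mat_kernel A \<inter> cball 0 1)"
    using closed_orthogonal_projection_onto [OF orthogonal_projection_onto_emb_kernel [OF A P]]
    by (intro closed_Int) auto
  show "\<And>f. f \<in> emb ` mat_kernel A \<inter> cball 0 1 \<Longrightarrow> Poly_Mapping.keys f \<subseteq> {..<n}"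
    using mat_kernelD(1) [OF A, THEN carrier_vecD]
    by (auto simp: in_keys_iff lookup_emb split: if_splits)
qed auto

section \<open>Stacked systems\<close>

lemma list_of_vec_mult_mat_vec: "list_of_vec (M *\<^sub>v z) = map (\<lambda>r. scalar_prod r z) (rows M)"
  by (simp add: list_of_vec_map rows_def)

lemma list_of_vec_eq_iff: "list_of_vec v = list_of_vec w \<longleftrightarrow> v = w"
  by (metis vec_list)

text \<open>Both sides are concatenations of blocks of matching lengths \<open>nr i\<close>, so they
  agree exactly when they agree block by block.\<close>

lemma stack_mat_mult_eq_stack_vec_iff:
  assumes A: "\<And>i. i \<in> {1..m} \<Longrightarrow> A i \<in> carrier_mat (nr i) n"
    and b: "\<And>i. i \<in> {1..m} \<Longrightarrow> b i \<in> carrier_vec (nr i)"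
  shows "stack_mat n m A *\<^sub>v z = stack_vec m b \<longleftrightarrow> (\<forall>i\<in>{1..m}. A i *\<^sub>v z = b i)"
proof -
  let ?rs = "concat (map (\<lambda>i. rows (A i)) [1..<Suc m])"
  have "set ?rs \<subseteq> carrier_vec n"
    using A by (fastforce simp: rows_def)
  then have rows: "rows (stack_mat n m A) = ?rs"
    unfolding stack_mat_def by (rule rows_mat_of_rows)
  have "stack_mat n m A *\<^sub>v z = stack_vec m b \<longleftrightarrow>
      list_of_vec (stack_mat n m A *\<^sub>v z) = list_of_vec (stack_vec m b)"
    by (simp add: list_of_vec_eq_iff)
  also have "\<dots> \<longleftrightarrow> concat (map (\<lambda>i. list_of_vec (A i *\<^sub>v z)) [1..<Suc m])
      = concat (map (\<lambda>i. list_of_vec (b i)) [1..<Suc m])"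
    by (simp add: list_of_vec_mult_mat_vec rows map_concat stack_vec_def list_vec comp_def del: upt_Suc)
  also have "\<dots> \<longleftrightarrow> map (\<lambda>i. list_of_vec (A i *\<^sub>v z)) [1..<Suc m] = map (\<lambda>i. list_of_vec (b i)) [1..<Suc m]"
  proof (rule concat_eq_concat_iff)
    show "\<forall>(xs, ys)\<in>set (zip (map (\<lambda>i. list_of_vec (A i *\<^sub>v z)) [1..<Suc m])
        (map (\<lambda>i. list_of_vec (b i)) [1..<Suc m])). length xs = length ys"
      using A b by (fastforce simp: zip_map_map zip_same_conv_map simp del: upt_Suc)
  qed simp
  also have "\<dots> \<longleftrightarrow> (\<forall>i\<in>{1..m}. A i *\<^sub>v z = b i)"
    by (simp add: list_of_vec_eq_iff atLeastLessThanSuc_atLeastAtMost del: upt_Suc)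
  finally show ?thesis .
qed

section \<open>The distributed algorithm\<close>

lemma finsum_vec_diff:
  assumes "finite S" "\<And>j. j \<in> S \<Longrightarrow> y j \<in> carrier_vec n" "z \<in> carrier_vec n" "k < n"
  shows "finsum_vec TYPE(real) n y S $ k = (\<Sum>j\<in>S. (y j - z) $ k) + real (card S) * z $ k"
proof -
  have "finsum_vec TYPE(real) n y S $ k = (\<Sum>j\<in>S. y j $ k)"
    using assms by (intro index_finsum_vec) auto
  also have "\<dots> = (\<Sum>j\<in>S. (y j - z) $ k + z $ k)"
    using assms by (intro sum.cong) auto
  finally show ?thesis
    by (simp add: sum.distrib)
qed

text \<open>With \<open>y = x i - z\<close> fixed by \<open>P\<close> and \<open>w\<close> the
  average error, the bracket equals \<open>card S\<close> times \<open>y - w\<close>. The update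
  becomes x i - (y - P w) = z + P w, which is projected averaging of errors.\<close>

lemma agent_update:
  fixes x :: "nat \<Rightarrow> real vec"
  assumes A: "A \<in> carrier_mat r n" and P: "is_orthogonal_projection n (mat_kernel A) P"
    and S: "finite S" "S \<noteq> {}" and x: "\<And>j. j \<in> insert i S \<Longrightarrow> x j \<in> carrier_vec n"
    and z: "z \<in> carrier_vec n" and ker: "x i - z \<in> mat_kernel A"
    and x': "x' = x i - (1 / real (card S)) \<cdot>\<^sub>v
      (P *\<^sub>v (real (card S) \<cdot>\<^sub>v x i - finsum_vec TYPE(real) n x S))"
  shows "x' - z = P *\<^sub>v unemb n ((1 / real (card S)) *\<^sub>R (\<Sum>j\<in>S. emb (x j - z)))"
proof -
  define w where "w = unemb n ((1 / real (card S)) *\<^sub>R (\<Sum>j\<in>S. emb (x j - z)))"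
  define y where "y = x i - z"
  have card: "real (card S) \<noteq> 0"
    using S by simp
  have P_carrier: "P \<in> carrier_mat n n"
    using P by (simp add: is_orthogonal_projection_def)
  have x_i: "x i \<in> carrier_vec n"
    using x by simp
  have w: "w \<in> carrier_vec n" and y: "y \<in> carrier_vec n"
    using x z by (auto simp: w_def y_def)
  have "emb (P *\<^sub>v unemb n (emb y)) = emb y"
    using orthogonal_projection_id [OF orthogonal_projection_onto_emb_kernel [OF A P]] ker
    by (simp add: y_def)
  then have Py: "P *\<^sub>v y = y"
    using unemb_emb [of _ n] y P_carrier by (metis mult_mat_vec_carrier)
  have "real (card S) \<cdot>\<^sub>v x i - finsum_vec TYPE(real) n x S = real (card S) \<cdot>\<^sub>v (y - w)"
  proof (rule eq_vecI)
    have dim: "finsum_vec TYPE(real) n x S \<in> carrier_vec n"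
      using S x by (intro finsum_vec_closed) auto
    show "dim_vec (real (card S) \<cdot>\<^sub>v x i - finsum_vec TYPE(real) n x S) = dim_vec (real (card S) \<cdot>\<^sub>v (y - w))"
      using dim w by simp
    fix k assume "k < dim_vec (real (card S) \<cdot>\<^sub>v (y - w))"
    then have k: "k < n"
      using w by simp
    have "w $ k = (1 / real (card S)) * (\<Sum>j\<in>S. (x j - z) $ k)"
      using k x z by (auto simp: w_def unemb_def lookup_sum lookup_emb intro!: sum.cong)
    moreover have "finsum_vec TYPE(real) n x S $ k = (\<Sum>j\<in>S. (x j - z) $ k) + real (card S) * z $ k"
      using S x z k by (intro finsum_vec_diff) auto
    moreover have "k < dim_vec (x i)"
      using x_i k by simp
    ultimately show "(real (card S) \<cdot>\<^sub>v x i - finsum_vec TYPE(real) n x S) $ k = (real (card S) \<cdot>\<^sub>v (y - w)) $ k"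
      using k z w dim card
      by (simp add: y_def field_simps)
  qed
  then have "x' = x i - (1 / real (card S)) \<cdot>\<^sub>v (real (card S) \<cdot>\<^sub>v (y - P *\<^sub>v w))"
    using x' w y P_carrier Py by (simp add: mult_mat_vec [of _ n n] mult_minus_distrib_mat_vec [of _ n n])
  also have "\<dots> = z + P *\<^sub>v w"
    using x_i z w P_carrier card
    by (intro eq_vecI) (auto simp: y_def)
  finally show ?thesis
    using z w P_carrier by (auto simp: w_def intro!: eq_vecI)
qed

theorem theorem1:
  fixes m n :: nat
    and nr :: "nat \<Rightarrow> nat"
    and A P :: "nat \<Rightarrow> real mat"
    and b :: "nat \<Rightarrow> real vec"
    and N :: "nat \<Rightarrow> nat \<Rightarrow> nat set"
    and x :: "nat \<Rightarrow> nat \<Rightarrow> real vec"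
  assumes m: "m > 1" and n: "n \<ge> 1"
    and A: "\<And>i. i \<in> {1..m} \<Longrightarrow> A i \<in> carrier_mat (nr i) n"
    and b: "\<And>i. i \<in> {1..m} \<Longrightarrow> b i \<in> carrier_vec (nr i)"
    and solvable: "\<exists>z\<in>carrier_vec n. stack_mat n m A *\<^sub>v z = stack_vec m b"
    and P: "\<And>i. i \<in> {1..m} \<Longrightarrow> is_orthogonal_projection n (mat_kernel (A i)) (P i)"
    and N: "\<And>i t. i \<in> {1..m} \<Longrightarrow> t \<ge> 1 \<Longrightarrow> N i t \<subseteq> {1..m} \<and> i \<in> N i t"
    and x: "\<And>i t. i \<in> {1..m} \<Longrightarrow> t \<ge> 1 \<Longrightarrow> x i t \<in> carrier_vec n"
    and init: "\<And>i. i \<in> {1..m} \<Longrightarrow> A i *\<^sub>v x i 1 = b i"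
    and update: "\<And>i t. i \<in> {1..m} \<Longrightarrow> t \<ge> 1 \<Longrightarrow>
          x i (t + 1) = x i t - (1 / real (card (N i t))) \<cdot>\<^sub>v
            (P i *\<^sub>v (real (card (N i t)) \<cdot>\<^sub>v x i t
                     - finsum_vec TYPE(real) n (\<lambda>j. x j t) (N i t)))"
    and connected: "repeatedly_jointly_strongly_connected (\<lambda>t. neighbor_graph m (\<lambda>i. N i t))"
  shows "\<exists>\<rho>>0. \<rho> < 1 \<and>
           (\<exists>z\<in>carrier_vec n. stack_mat n m A *\<^sub>v z = stack_vec m b \<and>
              (\<forall>i\<in>{1..m}. (\<lambda>t. vec_norm2 (x i t - z)) \<longlonglongrightarrow> 0 \<and>
                          converges_as_fast_as (x i) z \<rho>))"
proof -
  let ?V = "{1..m}"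
  obtain z where z: "z \<in> carrier_vec n" "\<And>i. i \<in> ?V \<Longrightarrow> A i *\<^sub>v z = b i"
    using solvable stack_mat_mult_eq_stack_vec_iff [of m A nr n b, OF A b] by blast
  define W where "W i = emb ` mat_kernel (A i)" for i
  define p where "p i f = emb (P i *\<^sub>v unemb n f)" for i f
  \<comment> \<open>Time starts at 1 for the agents and at 0 in
    \<open>geometric_convergence\<close>, hence \<open>Suc t\<close>; the restriction makes the
    neighbor maps extensional, as \<open>graphs\<close> requires.\<close>
  define g where "g t = restrict (\<lambda>i. N i (Suc t)) ?V" for t
  define e where "e t i = emb (x i (Suc t) - z)" for t i
  have N_nonempty: "finite (N i (Suc t))" "N i (Suc t) \<noteq> {}" if "i \<in> ?V" for i t
    using N [OF that, of "Suc t"] by (auto intro: finite_subset)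
  interpret projected_averaging ?V W p
  proof
    fix i assume i: "i \<in> ?V"
    show "orthogonal_projection_onto (W i) (p i)" "compact (W i \<inter> cball 0 1)"
      unfolding W_def p_def
      by (rule orthogonal_projection_onto_emb_kernel compact_emb_kernel; rule A [OF i] P [OF i])+
  qed (use m in auto)
  have step: "x i (Suc (Suc t)) - z = P i *\<^sub>v unemb n ((1 / real (card (g t i))) *\<^sub>R (\<Sum>j\<in>g t i. e t j))"
    if "i \<in> ?V" "x i (Suc t) - z \<in> mat_kernel (A i)" for i t
    using that N [OF that(1), of "Suc t"] N_nonempty [OF that(1), of t] update [OF that(1), of "Suc t"] x z(1)
    unfolding e_def g_def
    by (simp, intro agent_update [OF A P, where i = i and x = "\<lambda>j. x j (Suc t)"]) auto
  \<comment> \<open>Initially both \<open>x i 1\<close> and \<open>z\<close> solve the system of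
    agent \<open>i\<close>; afterwards every error is a value of \<open>P i\<close>. The induction
    is needed because \<open>step\<close> presupposes kernel membership at the current time.\<close>
  have ker: "x i (Suc t) - z \<in> mat_kernel (A i)" if i: "i \<in> ?V" for i t
  proof (induction t)
    case 0
    then show ?case
      using i init [OF i] z x [OF i, of 1] A [OF i] b [OF i]
      by (intro mat_kernelI [OF A [OF i]]) (auto simp: mult_minus_distrib_mat_vec [OF A [OF i]])
  next
    case (Suc t)
    then show ?case
      using step [OF i Suc] P [OF i] by (simp add: is_orthogonal_projection_def)
  qed
  obtain L T where LT: "L > 0" "T > 0" and conn:
    "\<And>k. ?V \<times> ?V \<subseteq> walks ?V (map (\<lambda>t i. N i t) [T + k * L..<T + Suc k * L])"
    by (rule repeatedly_jointly_strongly_connected_walks [OF connected N]) (use m in auto)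
  have "\<exists>u\<in>common. \<exists>\<rho>>0. \<rho> < 1 \<and> (\<exists>c. \<forall>t. \<forall>i\<in>?V. norm (e t i - u) \<le> c * \<rho> ^ t)"
  \<comment> \<open>\<open>T - 1\<close> undoes the time shift in \<open>g\<close>; it is exact
    because \<open>T\<close> is positive.\<close>
  proof (rule geometric_convergence [of g e L "T - 1"])
    show "g t \<in> graphs" for t
    proof -
      have "N i (Suc t) \<in> Pow ?V - {{}}" if "i \<in> ?V" for i
        using N [OF that, of "Suc t"] by auto
      then show ?thesis
        unfolding g_def graphs_def restrict_PiE_iff by blast
    qed
    show "e 0 i \<in> W i" if "i \<in> ?V" for i
      using ker [OF that, of 0] by (simp add: e_def W_def)
    show "e (Suc t) i = projected_average p (g t) (e t) i" if "i \<in> ?V" for t i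
      using step [OF that ker [OF that]] by (simp add: projected_average_def p_def e_def)
    show "?V \<times> ?V \<subseteq> walks ?V (map g [T - 1 + k * L..<T - 1 + Suc k * L])" for k
    proof -
      have "[T + k * L..<T + Suc k * L] = map Suc [T - 1 + k * L..<T - 1 + Suc k * L]"
        using LT(2) by (simp add: map_Suc_upt del: upt_Suc)
      then show ?thesis
        using conn [of k] by (simp only: g_def [abs_def] walks_restrict map_map comp_def)
    qed
  qed fact
  then obtain u \<rho> c where u: "u \<in> common" and \<rho>: "0 < \<rho>" "\<rho> < 1"
    and bound: "\<And>t i. i \<in> ?V \<Longrightarrow> norm (e t i - u) \<le> c * \<rho> ^ t"
    by blast
  \<comment> \<open>The errors relative to \<open>z\<close> converge to \<open>u\<close>, so adding
    the kernel vector \<open>u\<close> to \<open>z\<close> gives the solution that is actually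
    approached.\<close>
  define z' where "z' = z + unemb n u"
  have u_ker: "unemb n u \<in> mat_kernel (A i) \<and> emb (unemb n u) = u" if i: "i \<in> ?V" for i
  proof -
    obtain v where "v \<in> mat_kernel (A i)" "u = emb v"
      using u i unfolding common_def W_def by blast
    then show ?thesis
      using mat_kernelD(1) [OF A [OF i]] by (simp add: unemb_emb)
  qed
  have z': "z' \<in> carrier_vec n"
    using z by (simp add: z'_def)
  have "A i *\<^sub>v z' = b i" if i: "i \<in> ?V" for i
    using mat_kernelD [OF A [OF i] conjunct1 [OF u_ker [OF i]]] z(1) z(2) [OF i] b [OF i]
    by (simp add: z'_def mult_add_distrib_mat_vec [OF A [OF i]])
  then have "stack_mat n m A *\<^sub>v z' = stack_vec m b"
    using stack_mat_mult_eq_stack_vec_iff [of m A nr n b, OF A b] by blast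
  moreover have "(\<lambda>t. vec_norm2 (x i t - z')) \<longlonglongrightarrow> 0 \<and> converges_as_fast_as (x i) z' \<rho>"
    if i: "i \<in> ?V" for i
  proof -
    have norm_eq: "vec_norm2 (x i (Suc t) - z') = norm (e t i - u)" for t
    proof -
      have "x i (Suc t) \<in> carrier_vec n"
        using x [OF i] by simp
      then have "x i (Suc t) - z' = (x i (Suc t) - z) - unemb n u" "x i (Suc t) - z \<in> carrier_vec n"
        using z(1) by (auto simp: z'_def intro!: eq_vecI)
      then have "emb (x i (Suc t) - z') = e t i - u"
        using emb_diff [of "x i (Suc t) - z" n "unemb n u"] u_ker [OF i] by (simp add: e_def)
      then show ?thesis
        using norm_emb [of "x i (Suc t) - z'"] by simp
    qed
    have "(\<lambda>t. c * \<rho> ^ t) \<longlonglongrightarrow> 0"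
      using tendsto_mult_right_zero [OF LIMSEQ_power_zero [of \<rho>], of c] \<rho> by simp
    then have "(\<lambda>t. vec_norm2 (x i (Suc t) - z')) \<longlonglongrightarrow> 0"
      unfolding norm_eq
      by (rule tendsto_sandwich [OF _ _ tendsto_const, rotated 2]) (use bound [OF i] in auto)
    then have "(\<lambda>t. vec_norm2 (x i t - z')) \<longlonglongrightarrow> 0"
      by (rule LIMSEQ_imp_Suc)
    \<comment> \<open>Dividing \<open>c\<close> by \<rho> compensates for the error index being
      \<open>t - 1\<close>.\<close>
    moreover have "vec_norm2 (x i t - z') \<le> c / \<rho> * \<rho> ^ t" if "t \<ge> 1" for t
      using bound [OF i, of "t - 1"] norm_eq [of "t - 1"] that \<rho>(1) by (cases t) auto
    ultimately show ?thesis
      unfolding converges_as_fast_as_def by blast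
  qed
  ultimately show ?thesis
    using z' \<rho> by blast
qed

end
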